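(* Let $m \geq 2$ and $2 \leq k \leq m$ be integers, and let $n = \binom{m}{k-1} + \binom{m}{k}$ be the number of vertices of the Levi graph $L_1(m,k)$. Then the path number of $L_1(m,k)$ is less than or equal to $\left\lfloor \frac{n}{2} \right\rfloor$.
   Context: Write $[m] = \{1,2,\dots,m\}$. The Levi graph of order one, $L_1(m,k)$, is the bipartite simple graph with vertex partition $(A,B)$, where $A$ is the set of all $(k-1)$-element subsets of $[m]$ and $B$ is the set of all $k$-element subsets of $[m]$; a vertex $u \in A$ is adjacent to a vertex $v \in B$ if and only if $u \subset v$ (proper containment), and there are no other edges. A path in a graph is a sequence of distinct vertices $v_1, v_2, \dots, v_t$ with $v_i$ adjacent to $v_{i+1}$ for all $1 \le i \le t-1$, together with the edges $v_iv_{i+1}$. A path decomposition of a graph $G$ is a finite collection $\mathcal{P} = \{P_1, \dots, P_K\}$ of paths in $G$ such that $\bigcup_i E(P_i) = E(G)$ and $E(P_i) \cap E(P_j) = \emptyset$ for $i \neq j$. Its size is the number $K$ of paths. The path number of $G$ is the minimum size of a path decomposition of $G$. *)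

theory Defs imports Main begin

text \<open>A graph is a pair of a vertex set and a set of edges, each edge being a two-element set of
  vertices.\<close>

type_synonym 'v graph = "'v set \<times> 'v set set"

abbreviation verts :: "'v graph \<Rightarrow> 'v set" where
  "verts \<equiv> fst"

abbreviation edges :: "'v graph \<Rightarrow> 'v set set" where
  "edges \<equiv> snd"

definition simple_graph :: "'v graph \<Rightarrow> bool" where
  "simple_graph G \<longleftrightarrow> (\<forall>e\<in>edges G. e \<subseteq> verts G \<and> card e = 2)"

definition adjacent :: "'v graph \<Rightarrow> 'v \<Rightarrow> 'v \<Rightarrow> bool" where
  "adjacent G u v \<longleftrightarrow> {u, v} \<in> edges G"

definition is_path :: "'v graph \<Rightarrow> 'v list \<Rightarrow> bool" where
  "is_path G p \<longleftrightarrow> p \<noteq> [] \<and> set p \<subseteq> verts G \<and> distinct p \<and>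
     (\<forall>i. Suc i < length p \<longrightarrow> adjacent G (p ! i) (p ! Suc i))"

definition path_edges :: "'v list \<Rightarrow> 'v set set" where
  "path_edges p = {{p ! i, p ! Suc i} | i. Suc i < length p}"

definition path_decomposition :: "'v graph \<Rightarrow> 'v list set \<Rightarrow> bool" where
  "path_decomposition G P \<longleftrightarrow> finite P \<and> (\<forall>p\<in>P. is_path G p) \<and>
     (\<Union>p\<in>P. path_edges p) = edges G \<and>
     (\<forall>p\<in>P. \<forall>q\<in>P. p \<noteq> q \<longrightarrow> path_edges p \<inter> path_edges q = {})"

text \<open>The minimum is meaningful only if some path decomposition exists; lemma
  \<open>path_number_attained\<close> below shows that this is so for every finite simple graph.\<close>

definition path_number :: "'v graph \<Rightarrow> nat" where
  "path_number G = (LEAST K. \<exists>P. path_decomposition G P \<and> card P = K)"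

definition levi_A :: "nat \<Rightarrow> nat \<Rightarrow> nat set set" where
  "levi_A m k = {u. u \<subseteq> {1..m} \<and> card u = k - 1}"

definition levi_B :: "nat \<Rightarrow> nat \<Rightarrow> nat set set" where
  "levi_B m k = {v. v \<subseteq> {1..m} \<and> card v = k}"

definition levi_graph :: "nat \<Rightarrow> nat \<Rightarrow> nat set graph" where
  "levi_graph m k = (levi_A m k \<union> levi_B m k,
     {{u, v} | u v. u \<in> levi_A m k \<and> v \<in> levi_B m k \<and> u \<subset> v})"

lemma simple_graph_levi_graph: "simple_graph (levi_graph m k)"
  by (auto simp: simple_graph_def levi_graph_def card_2_iff)

lemma finite_levi_graph: "finite (verts (levi_graph m k))"
  by (auto simp: levi_graph_def levi_A_def levi_B_def)

lemma card_verts_levi_graph: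
  assumes "1 \<le> k"
  shows "card (verts (levi_graph m k)) = (m choose (k - 1)) + (m choose k)"
proof -
  have "levi_A m k \<inter> levi_B m k = {}"
    using assms by (auto simp: levi_A_def levi_B_def)
  moreover have "finite (levi_A m k)" "finite (levi_B m k)"
    by (auto simp: levi_A_def levi_B_def)
  moreover have "card (levi_A m k) = m choose (k - 1)" "card (levi_B m k) = m choose k"
    using n_subsets[of "{1..m}"] by (simp_all add: levi_A_def levi_B_def)
  ultimately show ?thesis
    by (simp add: levi_graph_def card_Un_disjoint)
qed

lemma path_edges_two: "path_edges [u, v] = {{u, v}}"
  by (auto simp: path_edges_def)

lemma path_decomposition_exists:
  assumes "simple_graph G" "finite (verts G)"
  shows "\<exists>P. path_decomposition G P"
proof -
  have fin: "finite (edges G)"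
    using assms by (intro finite_subset[of "edges G" "Pow (verts G)"])
      (auto simp: simple_graph_def)
  have "\<forall>e\<in>edges G. \<exists>p. is_path G p \<and> path_edges p = {e}"
  proof
    fix e assume e: "e \<in> edges G"
    then obtain u v where "e = {u, v}" "u \<noteq> v" "u \<in> verts G" "v \<in> verts G"
      using assms(1) by (fastforce simp: simple_graph_def card_2_iff)
    then have "is_path G [u, v]" "path_edges [u, v] = {e}"
      using e by (auto simp: is_path_def adjacent_def path_edges_two less_Suc_eq)
    then show "\<exists>p. is_path G p \<and> path_edges p = {e}" by blast
  qed
  then obtain f where f: "\<forall>e\<in>edges G. is_path G (f e) \<and> path_edges (f e) = {e}"
    by metis
  then have "path_decomposition G (f ` edges G)"
    using fin by (auto simp: path_decomposition_def)
  then show ?thesis by blast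
qed

lemma path_number_attained:
  assumes "simple_graph G" "finite (verts G)"
  shows "\<exists>P. path_decomposition G P \<and> card P = path_number G"
  unfolding path_number_def by (rule LeastI_ex) (use path_decomposition_exists[OF assms] in blast)

end

theory Submission imports Defs "HOL-Library.Multiset" begin

text \<open>A family of paths in which every vertex of a graph is an end exactly once has half as many
  paths as the graph has vertices. When all degrees are odd such a decomposition exists; this is
  Lovasz's theorem on path coverings, proved here in the form \<open>decomposition_with_prescribed_ends\<close>:
  the number of times that each vertex is to be an end may be prescribed freely, as long as it has
  the parity of the degree and is positive at all non-isolated vertices but one. The proof is an
  induction on the number of edges. Removing an edge \<open>{u, x}\<close> turns an end at \<open>u\<close> into an end at
  \<open>x\<close>, and \<open>add_edge\<close> puts the edge back: a path ending at \<open>x\<close> is extended to \<open>u\<close>, after some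
  paths through \<open>u\<close> have been rerouted if necessary.

  In the Levi graph, the \<open>(k - 1)\<close>-sets have degree \<open>m + 1 - k\<close> and the \<open>k\<close>-sets have degree \<open>k\<close>.
  If both numbers are odd, the above applies. If one of them is even, split the sets by whether
  they contain a given element \<open>a\<close>. The two halves are graphs of the same kind, and the remaining
  edges \<open>{S, S \<union> {a}}\<close> form a matching between the \<open>(k - 1)\<close>-sets without \<open>a\<close> and the \<open>k\<close>-sets
  with \<open>a\<close>. In its half, each vertex at one side of this matching has a degree that is one less
  than an even number, so some path ends there. The matching edges can therefore be appended to the
  paths of that half, and no new path is needed: all appended edges lead to distinct vertices of the
  other half, so the extended paths are still paths. Hence the bound for the two halves gives the
  bound for the whole graph (\<open>covers_decomposition\<close>).

  So that both halves have literally the same form, the induction runs over two consecutive levels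
  of an interval \<open>{S. R \<subseteq> S \<and> S \<subseteq> U}\<close> of the Boolean lattice, with fixed \<open>k\<close>: the half without \<open>a\<close>
  removes \<open>a\<close> from \<open>U\<close> and the half with \<open>a\<close> adds it to \<open>R\<close>.\<close>

section \<open>Families of paths with prescribed edges and ends\<close>

fun walk_edges :: "'v list \<Rightarrow> 'v set multiset" where
  "walk_edges (a # b # p) = add_mset {a, b} (walk_edges (b # p))"
| "walk_edges p = {#}"

text \<open>Equality of multisets says at once that the paths cover the edges and that they are
  edge-disjoint. One-vertex paths are admitted: they have no edges but count twice as an end, which
  makes it possible to prescribe the ends of a family on a graph without edges.\<close>

definition decomposes :: "'v list multiset \<Rightarrow> 'v set set \<Rightarrow> bool" where
  "decomposes D E \<longleftrightarrow> finite E \<and> (\<forall>p\<in>#D. p \<noteq> [] \<and> distinct p) \<and>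
     (\<Sum>p\<in>#D. walk_edges p) = mset_set E"

definition ends :: "'v list multiset \<Rightarrow> 'v multiset" where
  "ends D = (\<Sum>p\<in>#D. {#hd p, last p#})"

definition degree :: "'v set set \<Rightarrow> 'v \<Rightarrow> nat" where
  "degree E v = card {e \<in> E. v \<in> e}"

lemma walk_edges_append:
  assumes "p \<noteq> []" "q \<noteq> []"
  shows "walk_edges (p @ q) = add_mset {last p, hd q} (walk_edges p + walk_edges q)"
  using assms
proof (induction p rule: walk_edges.induct)
  case ("2_2" v)
  then show ?case by (cases q) auto
qed auto

lemma walk_edges_rev: "walk_edges (rev p) = walk_edges p"
proof (induction p rule: walk_edges.induct)
  case (1 a b p)
  then show ?case
    using walk_edges_append[of "rev (b # p)" "[a]"] by (simp add: insert_commute)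
qed auto

lemma path_edges_eq_walk_edges: "path_edges p = set_mset (walk_edges p)"
proof (induction p rule: walk_edges.induct)
  case (1 a b p)
  have image: "path_edges q = (\<lambda>i. {q ! i, q ! Suc i}) ` {i. Suc i < length q}" for q :: "'a list"
    by (auto simp: path_edges_def)
  have "{i. Suc i < length (a # b # p)} = insert 0 (Suc ` {i. Suc i < length (b # p)})"
    by (auto simp: image_iff gr0_conv_Suc) presburger
  then have "path_edges (a # b # p) = insert {a, b} (path_edges (b # p))"
    unfolding image by (simp only: image_insert image_image nth_Cons_0 nth_Cons_Suc)
  with 1 show ?case by simp
qed (auto simp: path_edges_def)

lemma decomposes_add_mset_iff:
  "decomposes (add_mset p D) E \<longleftrightarrow> finite E \<and> p \<noteq> [] \<and> distinct p \<and>
     (\<forall>q\<in>#D. q \<noteq> [] \<and> distinct q) \<and> walk_edges p + (\<Sum>q\<in>#D. walk_edges q) = mset_set E"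
  by (auto simp: decomposes_def)

lemma decomposes_union:
  assumes "decomposes D E" "decomposes D' E'" "E \<inter> E' = {}"
  shows "decomposes (D + D') (E \<union> E')"
  using assms by (auto simp: decomposes_def mset_set_Union)

lemma walk_edges_subset:
  assumes "decomposes D E" "p \<in># D"
  shows "set_mset (walk_edges p) \<subseteq> E"
proof -
  obtain D0 where D: "D = add_mset p D0" using assms(2) by (metis insert_DiffM)
  have "walk_edges p \<subseteq># mset_set E"
    using assms(1) unfolding D decomposes_add_mset_iff by (metis mset_subset_eq_add_left)
  then have "set_mset (walk_edges p) \<subseteq> set_mset (mset_set E)" by (rule set_mset_mono)
  then show ?thesis using assms(1) by (auto simp: decomposes_def)
qed

lemma ends_add_mset [simp]: "ends (add_mset p D) = add_mset (hd p) (add_mset (last p) (ends D))"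
  by (simp add: ends_def)

lemma in_ends_iff: "v \<in># ends D \<longleftrightarrow> (\<exists>p\<in>#D. v = hd p \<or> v = last p)"
  by (auto simp: ends_def)

lemma size_ends: "size (ends D) = 2 * size D"
  by (induction D) (auto simp: ends_def)

lemma even_incidences_plus_ends:
  assumes "p \<noteq> []" "distinct p"
  shows "even (size (filter_mset (\<lambda>e. v \<in> e) (walk_edges p)) + count {#hd p, last p#} v)"
  using assms
proof (induction p rule: walk_edges.induct)
  case (1 a b p)
  then show ?case by (auto split: if_splits)
qed auto

text \<open>A path uses an even number of edges at each of its inner vertices and an odd number at its
  ends. Hence a vertex of odd degree is an end of some path of the family.\<close>

lemma even_degree_plus_ends:
  assumes "decomposes D E"
  shows "even (degree E v + count (ends D) v)"
proof -
  have "degree E v = size (filter_mset (\<lambda>e. v \<in> e) (mset_set E))"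
    using assms by (simp add: degree_def decomposes_def filter_mset_mset_set)
  also have "mset_set E = (\<Sum>p\<in>#D. walk_edges p)"
    using assms by (simp add: decomposes_def)
  also have "even (size (filter_mset (\<lambda>e. v \<in> e) (\<Sum>p\<in>#D. walk_edges p)) + count (ends D) v)"
    if "\<forall>p\<in>#D. p \<noteq> [] \<and> distinct p"
    using that
  proof (induction D)
    case empty
    then show ?case by (simp add: ends_def)
  next
    case (add p D)
    have "even (size (filter_mset (\<lambda>e. v \<in> e) (walk_edges p)) + count {#hd p, last p#} v)"
      using add.prems by (intro even_incidences_plus_ends) auto
    moreover have "even (size (filter_mset (\<lambda>e. v \<in> e) (\<Sum>p\<in>#D. walk_edges p)) + count (ends D) v)"
      using add by auto
    ultimately show ?case by (auto split: if_splits)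
  qed
  ultimately show ?thesis using assms by (simp add: decomposes_def)
qed

lemma odd_degree_in_ends:
  assumes "decomposes D E" "odd (degree E v)"
  shows "v \<in># ends D"
  using even_degree_plus_ends[OF assms(1), of v] assms(2) by (metis count_inI dvd_0_right even_add)

section \<open>Adding an edge\<close>

text \<open>Reading a path from either of its ends gives a list that starts at that end. Membership in
  \<open>oriented D\<close> thus amounts to choosing a path of \<open>D\<close> together with one of its ends.\<close>

definition oriented :: "'v list multiset \<Rightarrow> 'v list set" where
  "oriented D = set_mset D \<union> rev ` set_mset D"

lemma oriented_add_mset: "oriented (add_mset p D) = {p, rev p} \<union> oriented D"
  by (auto simp: oriented_def)

lemma reorient:
  assumes "decomposes D E" "q \<in> oriented D"
  obtains D0 where "decomposes (add_mset q D0) E" "ends (add_mset q D0) = ends D"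
    "oriented (add_mset q D0) = oriented D"
proof -
  obtain p where p: "p \<in># D" "q = p \<or> q = rev p" using assms(2) by (auto simp: oriented_def)
  then obtain D0 where D: "D = add_mset p D0" by (metis insert_DiffM)
  have "p \<noteq> []" using assms(1) D by (simp add: decomposes_add_mset_iff)
  then have "decomposes (add_mset q D0) E" "ends (add_mset q D0) = ends D"
    "oriented (add_mset q D0) = oriented D"
    using p(2) assms(1) unfolding D
    by (auto simp: decomposes_add_mset_iff walk_edges_rev oriented_add_mset hd_rev last_rev)
  then show ?thesis by (rule that)
qed

lemma oriented_edge:
  assumes "decomposes D E" "q \<in> oriented D" "q = ys @ z # u # zs"
  shows "{u, z} \<in> E"
proof -
  obtain p where p: "p \<in># D" "q = p \<or> q = rev p" using assms(2) by (auto simp: oriented_def)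
  have "{u, z} \<in># walk_edges q"
    using walk_edges_append[of "ys @ [z]" "u # zs"] assms(3) by (simp add: insert_commute)
  then show ?thesis
    using walk_edges_subset[OF assms(1) p(1)] p(2) by (auto simp: walk_edges_rev)
qed

text \<open>A path that ends at \<open>x\<close> and avoids \<open>u\<close> can be extended by the new edge \<open>{u, x}\<close>. A path
  \<open>x \<dots> y, u, \<dots>\<close> that passes through \<open>u\<close> is rerouted to \<open>y \<dots> x, u, \<dots>\<close>; this uses \<open>{u, x}\<close>, leaves
  the edge \<open>{u, y}\<close> uncovered and moves the end from \<open>x\<close> to \<open>y\<close>, so that \<open>y\<close> takes over the role of
  \<open>x\<close>.

  The set \<open>L\<close> makes this process terminate. It collects the neighbours of \<open>u\<close> whose edges to \<open>u\<close>
  were covered by rerouting, and the process only continues with ends from which the path enters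
  \<open>u\<close> through a vertex outside \<open>L\<close>, so that no rerouting is undone. Rerouting affects the part of
  the path before \<open>u\<close> only; hence the required ends at the other neighbours persist, even when they
  are at the far side of the same path.\<close>

lemma rotate_and_extend:
  assumes "decomposes D E" "ends D = add_mset x C" "u \<noteq> x" "{u, x} \<notin> E"
    and "\<And>y. y = x \<or> {u, y} \<in> E \<and> y \<notin> L \<Longrightarrow>
      \<exists>q\<in>oriented D. hd q = y \<and> (\<forall>ys z zs. q = ys @ z # u # zs \<longrightarrow> z \<notin> L)"
    and "\<And>e. e \<in> E \<Longrightarrow> card e = 2"
  shows "\<exists>D'. decomposes D' (insert {u, x} E) \<and> ends D' = add_mset u C"
  using assms
proof (induction "card ({y. {u, y} \<in> E} - L)" arbitrary: D E x L rule: less_induct)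
  case less
  note free = less.prems(5)
  have finE: "finite E" using less.prems(1) by (simp add: decomposes_def)
  obtain q where q: "q \<in> oriented D" "hd q = x" "\<And>ys z zs. q = ys @ z # u # zs \<Longrightarrow> z \<notin> L"
    using free[of x] by auto
  obtain D0 where D0: "decomposes (add_mset q D0) E" "ends (add_mset q D0) = ends D"
    "oriented (add_mset q D0) = oriented D"
    using reorient[OF less.prems(1) q(1)] by blast
  then have q_path: "q \<noteq> []" "distinct q" by (auto simp: decomposes_add_mset_iff)
  have C: "C = add_mset (last q) (ends D0)"
    using D0(2) less.prems(2) q(2) by simp
  show ?case
  proof (cases "u \<in> set q")
    case False
    have "walk_edges (u # q) = add_mset {u, x} (walk_edges q)"
      using walk_edges_append[of "[u]" q] q_path(1) q(2) by simp
    then have "decomposes (add_mset (u # q) D0) (insert {u, x} E)"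
      using D0(1) False less.prems(4) by (simp add: decomposes_add_mset_iff)
    moreover have "ends (add_mset (u # q) D0) = add_mset u C"
      using C q_path(1) by simp
    ultimately show ?thesis by blast
  next
    case True
    obtain as zs where as: "q = as @ u # zs" using True by (meson split_list)
    have "as \<noteq> []" using as q(2) less.prems(3) by auto
    then obtain ys y where ys: "as = ys @ [y]" by (metis rev_exhaust)
    have q_eq: "q = ys @ y # u # zs" using as ys by simp
    have "y \<notin> L" using q(3)[OF q_eq] .
    define q' where "q' = rev as @ u # zs"
    define E' where "E' = insert {u, x} (E - {{u, y}})"
    have "u \<noteq> y" using q_path(2) q_eq by auto
    have last_rev_as: "last (rev as) = x" using \<open>as \<noteq> []\<close> as q(2) by (simp add: last_rev)
    have we_q: "walk_edges q = add_mset {y, u} (walk_edges as + walk_edges (u # zs))"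
      unfolding as using walk_edges_append[OF \<open>as \<noteq> []\<close>, of "u # zs"] ys by simp
    have we_q': "walk_edges q' = add_mset {x, u} (walk_edges as + walk_edges (u # zs))"
      unfolding q'_def using walk_edges_append[of "rev as" "u # zs"] \<open>as \<noteq> []\<close> last_rev_as
      by (simp add: walk_edges_rev)
    have uy: "{u, y} \<in> E"
      using walk_edges_subset[OF D0(1), of q] we_q by (auto simp: insert_commute)
    then have "x \<noteq> y" using less.prems(4) by auto
    have E: "E = insert {u, y} (E - {{u, y}})" using uy by blast
    have "mset_set E = add_mset {u, y} (mset_set (E - {{u, y}}))"
      using uy finE by (metis mset_set.remove)
    then have "mset_set E' = walk_edges q' + (\<Sum>p\<in>#D0. walk_edges p)"
      using D0(1) finE less.prems(4) we_q we_q'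
      by (auto simp: decomposes_add_mset_iff E'_def insert_commute)
    then have dec': "decomposes (add_mset q' D0) E'"
      using D0(1) finE q_path as
      by (auto simp: decomposes_add_mset_iff E'_def q'_def)
    have ends': "ends (add_mset q' D0) = add_mset y C"
      using C by (simp add: q'_def as ys)
    have uy': "{u, y} \<notin> E'" using \<open>x \<noteq> y\<close> by (auto simp: E'_def doubleton_eq_iff)
    have nbrs: "{v. {u, v} \<in> E'} = insert x ({v. {u, v} \<in> E} - {y})"
      using \<open>u \<noteq> y\<close> by (auto simp: E'_def doubleton_eq_iff)
    have "{v. {u, v} \<in> E'} - insert x L = ({v. {u, v} \<in> E} - L) - {y}"
      using less.prems(4) by (auto simp: nbrs)
    moreover have "finite ({v. {u, v} \<in> E} - L)"
    proof -
      have "finite (\<Union>{e \<in> E. finite e})" using finE by (intro finite_Union) auto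
      moreover have "{v. {u, v} \<in> E} \<subseteq> \<Union>{e \<in> E. finite e}" by auto
      ultimately show ?thesis by (meson finite_Diff finite_subset)
    qed
    ultimately have smaller: "card ({v. {u, v} \<in> E'} - insert x L) < card ({v. {u, v} \<in> E} - L)"
      using uy \<open>y \<notin> L\<close> by (simp add: card_gt_0_iff card_Diff1_less del: card_Diff_insert)
    have free': "\<exists>r\<in>oriented (add_mset q' D0). hd r = v \<and>
        (\<forall>ys z zs. r = ys @ z # u # zs \<longrightarrow> z \<notin> insert x L)"
      if "v = y \<or> {u, v} \<in> E' \<and> v \<notin> insert x L" for v
    proof -
      have v: "{u, v} \<in> E" "v \<notin> L" "v \<noteq> x"
        using that uy \<open>y \<notin> L\<close> \<open>x \<noteq> y\<close> by (auto simp: E'_def doubleton_eq_iff)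
      then have "v \<noteq> u" using less.prems(6) by fastforce
      obtain r where r: "r \<in> oriented D" "hd r = v" "\<And>ys z zs. r = ys @ z # u # zs \<Longrightarrow> z \<notin> L"
        using free[of v] v by blast
      \<comment> \<open>The edge \<open>{u, x}\<close> was uncovered so far, so no path could enter \<open>u\<close> through \<open>x\<close>.\<close>
      have old: "z \<noteq> x" if "r = ys @ z # u # zs" for ys z zs
        using oriented_edge[OF less.prems(1) r(1) that] less.prems(4) by auto
      show ?thesis
      proof (cases "r = rev q")
        case True
        \<comment> \<open>The end \<open>v\<close> is the far end of the rerouted path, where the approach to \<open>u\<close> is unchanged.\<close>
        then have r_eq: "r = rev zs @ u # rev as" using as by simp
        then have "zs \<noteq> []" using r(2) \<open>v \<noteq> u\<close> by auto
        have rev_q': "rev q' = rev zs @ u # as" by (simp add: q'_def)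
        have "z \<notin> insert x L" if eq: "rev q' = ws @ z # u # ws'" for ws z ws'
        proof -
          have "rev zs @ u # as = (ws @ [z]) @ u # ws'" using eq rev_q' by simp
          moreover have "u \<notin> set (rev zs)" "u \<notin> set as" using q_path(2) as by auto
          ultimately have "rev zs = ws @ [z]" by (metis append_Cons_eq_iff)
          then have "r = ws @ z # u # rev as" using r_eq by simp
          then show ?thesis using r(3) old by blast
        qed
        moreover have "hd (rev q') = v" using rev_q' r_eq r(2) \<open>zs \<noteq> []\<close> by simp
        ultimately show ?thesis by (intro bexI[of _ "rev q'"]) (auto simp: oriented_add_mset)
      next
        case False
        moreover have "r \<noteq> q" using r(2) v(3) q(2) by auto
        ultimately have "r \<in> oriented (add_mset q' D0)"
          using r(1) D0(3) by (auto simp: oriented_add_mset)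
        then show ?thesis using r old by blast
      qed
    qed
    have "card e = 2" if "e \<in> E'" for e
      using that less.prems(3,6) by (auto simp: E'_def)
    then have "\<exists>D'. decomposes D' (insert {u, y} E') \<and> ends D' = add_mset u C"
      using less.hyps[OF smaller dec' ends' \<open>u \<noteq> y\<close> uy' free'] by blast
    moreover have "insert {u, y} E' = insert {u, x} E" using E by (auto simp: E'_def)
    ultimately show ?thesis by simp
  qed
qed

lemma add_edge:
  assumes "decomposes D E" "\<And>e. e \<in> E \<Longrightarrow> card e = 2" "u \<noteq> x" "{u, x} \<notin> E"
    and "x \<in># ends D" "\<And>y. {u, y} \<in> E \<Longrightarrow> y \<in># ends D"
  obtains D' where "decomposes D' (insert {u, x} E)" "ends D' = add_mset u (ends D - {#x#})"
proof -
  have "\<exists>q\<in>oriented D. hd q = y" if y: "y \<in># ends D" for y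
  proof -
    obtain p where "p \<in># D" "y = hd p \<or> y = last p" using y by (auto simp: in_ends_iff)
    then have "p \<in> oriented D \<and> hd p = y \<or> rev p \<in> oriented D \<and> hd (rev p) = y"
      by (auto simp: oriented_def hd_rev)
    then show ?thesis by blast
  qed
  then have "\<exists>D'. decomposes D' (insert {u, x} E) \<and> ends D' = add_mset u (ends D - {#x#})"
    using assms by (intro rotate_and_extend[where L = "{}" and D = D]) auto
  then show ?thesis using that by blast
qed

text \<open>Since \<open>f w\<close> is incident with no other edge, it meets the condition of \<open>add_edge\<close> on
  neighbours as soon as a path ends at \<open>w\<close>. Adding \<open>{w, f w}\<close> removes an end at \<open>w\<close> only, so the
  remaining vertices of \<open>W\<close> still are ends; the last conclusion records this for the induction.\<close>

lemma attach_pendant_edges: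
  assumes "decomposes D E" "\<And>e. e \<in> E \<Longrightarrow> card e = 2" "finite W" "inj_on f W"
    and "\<And>w. w \<in> W \<Longrightarrow> w \<in># ends D" "\<And>w. w \<in> W \<Longrightarrow> f w \<notin> W \<union> \<Union>E"
  shows "\<exists>D'. decomposes D' (E \<union> (\<lambda>w. {w, f w}) ` W) \<and> size D' = size D \<and>
    (\<forall>v. v \<notin> W \<longrightarrow> v \<in># ends D \<longrightarrow> v \<in># ends D')"
  using assms(3,1,2,4-)
proof (induction W rule: finite_induct)
  case empty
  then show ?case by auto
next
  case (insert w W)
  let ?E = "E \<union> (\<lambda>w. {w, f w}) ` W"
  obtain D1 where D1: "decomposes D1 ?E" "size D1 = size D"
    "\<And>v. v \<notin> W \<Longrightarrow> v \<in># ends D \<Longrightarrow> v \<in># ends D1"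
    using insert.IH insert.prems by (auto simp: inj_on_insert)
  have fresh: "f w \<notin> \<Union>?E"
    using insert.prems(3,5) insert.hyps by (auto simp: inj_on_def)
  obtain D' where D': "decomposes D' (insert {f w, w} ?E)"
    "ends D' = add_mset (f w) (ends D1 - {#w#})"
  proof (rule add_edge[OF D1(1)])
    show "card e = 2" if "e \<in> ?E" for e
      using that insert.prems(2,5) by (auto simp: card_2_iff) (metis insertCI)
    show "f w \<noteq> w" using insert.prems(5)[of w] by auto
    show "{f w, w} \<notin> ?E" using fresh by blast
    show "y \<in># ends D1" if "{f w, y} \<in> ?E" for y using fresh that by blast
    show "w \<in># ends D1" using D1(3) insert by simp
  qed
  have "w \<in># ends D1" using D1(3) insert by simp
  then have "size (ends D') = size (ends D1)" using D'(2) size_Suc_Diff1 by fastforce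
  then have "size D' = size D1" by (simp add: size_ends)
  moreover have "v \<in># ends D'" if "v \<notin> insert w W" "v \<in># ends D" for v
    using D1(3)[of v] that D'(2) by (auto simp: in_diff_count)
  ultimately show ?case using D' D1(2) by (intro exI[of _ D']) (auto simp: insert_commute)
qed

section \<open>Prescribing the ends\<close>

lemma degree_insert:
  assumes "finite E" "{u, x} \<notin> E"
  shows "degree (insert {u, x} E) v = degree E v + (if v = u \<or> v = x then 1 else 0)"
proof -
  have "{e \<in> insert {u, x} E. v \<in> e} =
      (if v = u \<or> v = x then insert {u, x} {e \<in> E. v \<in> e} else {e \<in> E. v \<in> e})"
    by auto
  then show ?thesis using assms by (auto simp: degree_def)
qed

lemma trivial_paths_with_ends:
  assumes "\<And>v. even (count C v)"
  shows "\<exists>D. decomposes D {} \<and> ends D = C"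
  using assms
proof (induction "size C" arbitrary: C rule: less_induct)
  case less
  show ?case
  proof (cases "C = {#}")
    case True
    then show ?thesis by (intro exI[of _ "{#}"]) (simp add: decomposes_def ends_def)
  next
    case False
    then obtain v C1 where C1: "C = add_mset v C1" by (metis multiset_cases)
    then have "v \<in># C1" using less.prems[of v] by (metis count_add_mset count_inI even_Suc even_zero)
    then obtain C2 where C2: "C = add_mset v (add_mset v C2)" using C1 by (metis insert_DiffM)
    have "even (count C2 w)" for w using less.prems[of w] C2 by (auto split: if_splits)
    then obtain D where "decomposes D {}" "ends D = C2" using less.hyps[of C2] C2 by auto
    then show ?thesis
      using C2 by (intro exI[of _ "add_mset [v] D"]) (auto simp: decomposes_def)
  qed
qed

text \<open>The induction removes an edge \<open>{u, x}\<close> and prescribes one end less at \<open>u\<close> and one more at \<open>x\<close>.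
  This keeps the parity condition and makes \<open>u\<close> the only vertex that may have no end left. If there
  is an exceptional vertex \<open>w\<close> with an edge, then \<open>x\<close> must be chosen as \<open>w\<close>, which thereby gets an
  end. So all neighbours of \<open>u\<close> are ends, and \<open>add_edge\<close> restores the edge and the prescribed ends.
  The exceptional vertex has to be allowed because \<open>u\<close> becomes one.\<close>

theorem decomposition_with_prescribed_ends:
  assumes "finite E" "\<And>e. e \<in> E \<Longrightarrow> card e = 2"
    and "\<And>v. even (degree E v + count C v)"
    and "\<And>v. v \<in> \<Union>E \<Longrightarrow> v \<noteq> w \<Longrightarrow> v \<in># C"
  shows "\<exists>D. decomposes D E \<and> ends D = C"
  using assms
proof (induction "card E" arbitrary: E C w rule: less_induct)
  case less
  show ?case
  proof (cases "E = {}")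
    case True
    then show ?thesis using less.prems(3) trivial_paths_with_ends[of C] by (simp add: degree_def)
  next
    case False
    obtain u x where ux: "{u, x} \<in> E" "u \<noteq> x" and C: "\<And>v. v \<in> \<Union>E \<Longrightarrow> v \<noteq> x \<Longrightarrow> v \<in># C"
    proof (cases "w \<in> \<Union>E")
      case True
      then obtain e where e: "e \<in> E" "w \<in> e" by blast
      then obtain u where "e = {u, w}" "u \<noteq> w"
        using less.prems(2)[of e] by (auto simp: card_2_iff insert_commute)
      then show ?thesis using that[of u w] e less.prems(4) by blast
    next
      case False
      obtain e where "e \<in> E" using \<open>E \<noteq> {}\<close> by blast
      then obtain u x where "{u, x} \<in> E" "u \<noteq> x"
        using less.prems(2)[of e] by (auto simp: card_2_iff)
      then show ?thesis using that[of u x] False less.prems(4) by blast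
    qed
    define E0 where "E0 = E - {{u, x}}"
    define C0 where "C0 = add_mset x (C - {#u#})"
    have E: "E = insert {u, x} E0" "{u, x} \<notin> E0" "finite E0"
      using ux less.prems(1) by (auto simp: E0_def)
    have smaller: "card E0 < card E"
      unfolding E0_def using less.prems(1) ux(1) by (rule card_Diff1_less)
    have "u \<in># C" using C ux by blast
    then have C_eq: "C = add_mset u (C - {#u#})" by simp
    have parity: "even (degree E0 v + count C0 v)" for v
    proof -
      have "count C v = count (C - {#u#}) v + (if v = u then 1 else 0)"
        by (subst C_eq) simp
      then show ?thesis
        using less.prems(3)[of v] degree_insert[OF E(3,2), of v] ux(2)
        by (auto simp: C0_def simp flip: E(1) split: if_splits)
    qed
    have C0: "v \<in># C0" if "v \<in> \<Union>E0" "v \<noteq> u" for v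
      using that C[of v] by (auto simp: C0_def E0_def in_diff_count)
    have card_E0: "card e = 2" if "e \<in> E0" for e using that less.prems(2) by (simp add: E0_def)
    obtain D0 where D0: "decomposes D0 E0" "ends D0 = C0"
      using less.hyps[OF smaller E(3) card_E0 parity C0] by blast
    obtain D where D: "decomposes D (insert {u, x} E0)" "ends D = add_mset u (ends D0 - {#x#})"
    proof (rule add_edge[OF D0(1) card_E0 ux(2) E(2)])
      show "x \<in># ends D0" using D0(2) by (simp add: C0_def)
      show "y \<in># ends D0" if "{u, y} \<in> E0" for y
        using C0[of y] D0(2) that card_E0[of "{u, y}"] by (cases "y = u") auto
    qed
    then show ?thesis using E(1) C_eq D0(2) by (auto simp: C0_def)
  qed
qed

section \<open>Two consecutive levels of an interval of the Boolean lattice\<close>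

definition levels :: "'a set \<Rightarrow> 'a set \<Rightarrow> nat \<Rightarrow> 'a set set" where
  "levels R U k = {S. R \<subseteq> S \<and> S \<subseteq> U \<and> (Suc (card S) = k \<or> card S = k)}"

definition covers :: "'a set \<Rightarrow> 'a set \<Rightarrow> nat \<Rightarrow> 'a set set set" where
  "covers R U k = {{S, insert x S} | S x. R \<subseteq> S \<and> S \<subseteq> U \<and> x \<in> U - S \<and> Suc (card S) = k}"

lemma coversI:
  assumes "R \<subseteq> S" "S \<subseteq> U" "x \<in> U" "x \<notin> S" "Suc (card S) = k"
  shows "{S, insert x S} \<in> covers R U k"
  using assms unfolding covers_def by blast

lemma coversE:
  assumes "e \<in> covers R U k"
  obtains S x where "e = {S, insert x S}" "R \<subseteq> S" "S \<subseteq> U" "x \<in> U" "x \<notin> S" "Suc (card S) = k"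
  using assms unfolding covers_def by blast

lemma finite_levels: "finite U \<Longrightarrow> finite (levels R U k)"
  by (rule finite_subset[of _ "Pow U"]) (auto simp: levels_def)

lemma Union_covers_subset: "finite U \<Longrightarrow> \<Union>(covers R U k) \<subseteq> levels R U k"
proof -
  assume "finite U"
  then have "{S, insert x S} \<subseteq> levels R U k"
    if "R \<subseteq> S" "S \<subseteq> U" "x \<in> U - S" "Suc (card S) = k" for S x
    using that finite_subset[of S U] by (auto simp: levels_def)
  then show ?thesis unfolding covers_def by blast
qed

lemma finite_covers:
  assumes "finite U"
  shows "finite (covers R U k)"
  using finite_UnionD[OF finite_subset[OF Union_covers_subset[OF assms] finite_levels[OF assms]]] .

lemma card_covers: "e \<in> covers R U k \<Longrightarrow> card e = 2"
  by (auto simp: covers_def card_2_iff)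

lemma covers_eq_empty:
  assumes "finite U" "card U < k \<or> k \<le> card R"
  shows "covers R U k = {}"
proof -
  have False if "R \<subseteq> S" "S \<subseteq> U" "x \<in> U - S" "Suc (card S) = k" for S x
  proof -
    have "card R \<le> card S" using that assms(1) by (meson card_mono finite_subset)
    moreover have "card S < card U" using that assms(1) by (intro psubset_card_mono) auto
    ultimately show False using that(4) assms(2) by auto
  qed
  then show ?thesis by (auto simp: covers_def)
qed

lemma degree_lower:
  assumes "finite U" "R \<subseteq> S" "S \<subseteq> U" "Suc (card S) = k"
  shows "degree (covers R U k) S = card U + 1 - k"
proof -
  have fin: "finite S" using assms finite_subset by blast
  have "{e \<in> covers R U k. S \<in> e} = (\<lambda>x. {S, insert x S}) ` (U - S)"
  proof (intro equalityI subsetI)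
    fix e assume e: "e \<in> {e \<in> covers R U k. S \<in> e}"
    then obtain S' x where S': "e = {S', insert x S'}" "S' \<subseteq> U" "x \<in> U" "x \<notin> S'" "Suc (card S') = k"
      by (blast elim: coversE)
    then have "card (insert x S') = k" using assms(1) finite_subset by fastforce
    then have "S = S'" using e S'(1) assms(4) by auto
    then show "e \<in> (\<lambda>x. {S, insert x S}) ` (U - S)" using S' by blast
  next
    fix e assume "e \<in> (\<lambda>x. {S, insert x S}) ` (U - S)"
    then obtain x where "x \<in> U" "x \<notin> S" "e = {S, insert x S}" by blast
    then show "e \<in> {e \<in> covers R U k. S \<in> e}" using coversI[OF assms(2,3) _ _ assms(4)] by simp
  qed
  moreover have "inj_on (\<lambda>x. {S, insert x S}) (U - S)"
    by (auto simp: inj_on_def doubleton_eq_iff)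
  ultimately show ?thesis
    using assms fin by (simp add: degree_def card_image card_Diff_subset)
qed

lemma degree_upper:
  assumes "finite U" "R \<subseteq> T" "T \<subseteq> U" "card T = k"
  shows "degree (covers R U k) T = k - card R"
proof -
  have fin: "finite T" using assms finite_subset by blast
  have "{e \<in> covers R U k. T \<in> e} = (\<lambda>x. {T - {x}, T}) ` (T - R)"
  proof (intro equalityI subsetI)
    fix e assume e: "e \<in> {e \<in> covers R U k. T \<in> e}"
    then obtain S x where S: "e = {S, insert x S}" "R \<subseteq> S" "x \<notin> S" "Suc (card S) = k"
      by (blast elim: coversE)
    then have T: "T = insert x S" using e assms(4) by auto
    then have "S = T - {x}" "x \<in> T - R" using S by auto
    then show "e \<in> (\<lambda>x. {T - {x}, T}) ` (T - R)" using S(1) T by blast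
  next
    fix e assume "e \<in> (\<lambda>x. {T - {x}, T}) ` (T - R)"
    then obtain x where x: "x \<in> T" "x \<notin> R" "e = {T - {x}, T}" by blast
    have "Suc (card (T - {x})) = k" using card_Suc_Diff1[OF fin x(1)] assms(4) by simp
    then have "{T - {x}, insert x (T - {x})} \<in> covers R U k"
      using x assms by (intro coversI) auto
    then show "e \<in> {e \<in> covers R U k. T \<in> e}" using x by (simp add: insert_absorb)
  qed
  moreover have "inj_on (\<lambda>x. {T - {x}, T}) (T - R)"
    by (auto simp: inj_on_def doubleton_eq_iff)
  ultimately show ?thesis
    using assms fin by (simp add: degree_def card_image card_Diff_subset finite_subset)
qed

text \<open>An edge \<open>{S, S \<union> {x}}\<close> lies in the part with \<open>a\<close> or in the part without \<open>a\<close> unless \<open>x = a\<close>,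
  in which case it belongs to the matching between the two parts.\<close>

lemma covers_split:
  assumes "a \<in> U - R"
  shows "covers R U k = covers R (U - {a}) k \<union> covers (insert a R) U k \<union>
    {{S, insert a S} | S. R \<subseteq> S \<and> S \<subseteq> U - {a} \<and> Suc (card S) = k}" (is "_ = ?L \<union> ?H \<union> ?M")
proof (intro equalityI subsetI)
  fix e assume "e \<in> covers R U k"
  then obtain S x where S: "e = {S, insert x S}" "R \<subseteq> S" "S \<subseteq> U" "x \<in> U" "x \<notin> S" "Suc (card S) = k"
    unfolding covers_def by blast
  consider "x = a" | "x \<noteq> a" "a \<in> S" | "x \<noteq> a" "a \<notin> S" by blast
  then show "e \<in> ?L \<union> ?H \<union> ?M"
  proof cases
    case 1
    then have "S \<subseteq> U - {a}" using S by blast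
    then show ?thesis using S 1 by blast
  next
    case 2
    then have "e \<in> ?H" unfolding S(1) using S by (intro coversI) auto
    then show ?thesis by blast
  next
    case 3
    then have "e \<in> ?L" unfolding S(1) using S by (intro coversI) auto
    then show ?thesis by blast
  qed
next
  fix e assume "e \<in> ?L \<union> ?H \<union> ?M"
  then obtain S x where "e = {S, insert x S}" "R \<subseteq> S" "S \<subseteq> U" "x \<in> U" "x \<notin> S" "Suc (card S) = k"
    using assms unfolding covers_def by blast
  then show "e \<in> covers R U k" using coversI by metis
qed

lemma card_levels_split:
  assumes "finite U" "a \<in> U - R"
  shows "card (levels R U k) = card (levels R (U - {a}) k) + card (levels (insert a R) U k)"
proof -
  have "levels R U k = levels R (U - {a}) k \<union> levels (insert a R) U k"
    "levels R (U - {a}) k \<inter> levels (insert a R) U k = {}"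
    using assms by (auto simp: levels_def)
  then show ?thesis using assms by (simp add: card_Un_disjoint finite_levels)
qed

text \<open>The two numbers are the degrees of the lower and of the upper vertices. As they are odd,
  every vertex can be prescribed to be an end exactly once.\<close>

lemma covers_decomposition_odd:
  assumes "finite U" "odd (card U + 1 - k)" "odd (k - card R)"
  shows "\<exists>D. decomposes D (covers R U k) \<and> 2 * size D \<le> card (levels R U k)"
proof -
  let ?C = "mset_set (levels R U k)"
  have fin: "finite (levels R U k)" using assms(1) by (rule finite_levels)
  have "even (degree (covers R U k) v + count ?C v)" for v
  proof (cases "v \<in> levels R U k")
    case True
    then have "odd (degree (covers R U k) v)"
      using assms degree_lower[OF assms(1), of R v k] degree_upper[OF assms(1), of R v k]
      by (auto simp: levels_def)
    then show ?thesis using True fin by simp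
  next
    case False
    then have "{e \<in> covers R U k. v \<in> e} = {}" using Union_covers_subset[OF assms(1)] by blast
    then have "degree (covers R U k) v = 0" unfolding degree_def by (simp only: card.empty)
    then show ?thesis using False by simp
  qed
  moreover have "v \<in># ?C" if "v \<in> \<Union>(covers R U k)" for v
    using that Union_covers_subset[OF assms(1), of R k] fin by auto
  ultimately have "\<exists>D. decomposes D (covers R U k) \<and> ends D = ?C"
    by (intro decomposition_with_prescribed_ends[where w = "{}"] finite_covers[OF assms(1)] card_covers)
  then obtain D where D: "decomposes D (covers R U k)" "ends D = ?C" by blast
  have "2 * size D = card (levels R U k)" using size_ends[of D] D(2) by simp
  then show ?thesis using D(1) by auto
qed

text \<open>If a degree is even, passing to the half without \<open>a\<close> lowers the degree of the lower vertices
  by one, and passing to the half with \<open>a\<close> lowers that of the upper vertices by one. In the half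
  where the degree has become odd, the matching edges are appended to paths that end there.\<close>

theorem covers_decomposition:
  assumes "finite U" "R \<subseteq> U"
  shows "\<exists>D. decomposes D (covers R U k) \<and> 2 * size D \<le> card (levels R U k)"
  using assms
proof (induction "card (U - R)" arbitrary: R U rule: less_induct)
  case less
  note finU = less.prems(1)
  have empty: ?case if "covers R U k = {}"
    using that by (intro exI[of _ "{#}"]) (simp add: decomposes_def)
  show ?case
  proof (cases "card U < k \<or> k \<le> card R")
    case True
    then show ?thesis using empty covers_eq_empty[OF finU] by blast
  next
    case k: False
    then have "U \<noteq> R" by auto
    then obtain a where a: "a \<in> U - R" using less.prems(2) by blast
    have finR: "finite R" using less.prems finite_subset by blast
    let ?W = "{S. R \<subseteq> S \<and> S \<subseteq> U - {a} \<and> Suc (card S) = k}"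
    have finW: "finite ?W" by (rule finite_subset[of _ "Pow U"]) (use finU in auto)
    have finS: "finite S" if "S \<subseteq> U" for S using that finU finite_subset by blast
    have "card (U - {a} - R) < card (U - R)" "card (U - insert a R) < card (U - R)"
      by (rule psubset_card_mono; use a finU in blast)+
    then obtain D1 D2 where
      D1: "decomposes D1 (covers R (U - {a}) k)" "2 * size D1 \<le> card (levels R (U - {a}) k)" and
      D2: "decomposes D2 (covers (insert a R) U k)" "2 * size D2 \<le> card (levels (insert a R) U k)"
      using less.hyps[of "U - {a}" R] less.hyps[of U "insert a R"] less.prems a by auto
    have low: "a \<notin> v" if "v \<in> \<Union>(covers R (U - {a}) k)" for v
      using that Union_covers_subset[of "U - {a}" R k] finU by (auto simp: levels_def)
    have high: "a \<in> v" if "v \<in> \<Union>(covers (insert a R) U k)" for v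
      using that Union_covers_subset[OF finU, of "insert a R" k] by (auto simp: levels_def)
    have disjoint: "covers R (U - {a}) k \<inter> covers (insert a R) U k = {}"
      "(\<lambda>S. {S, insert a S}) ` ?W \<inter> covers (insert a R) U k = {}"
      "(\<lambda>S. {S, insert a S}) ` ?W \<inter> covers R (U - {a}) k = {}"
    proof -
      show "covers R (U - {a}) k \<inter> covers (insert a R) U k = {}"
      proof (rule equals0I)
        fix e assume e: "e \<in> covers R (U - {a}) k \<inter> covers (insert a R) U k"
        then obtain v where "v \<in> e" unfolding covers_def by blast
        then show False using e low[of v] high[of v] by blast
      qed
      show "(\<lambda>S. {S, insert a S}) ` ?W \<inter> covers (insert a R) U k = {}" using high by blast
      show "(\<lambda>S. {S, insert a S}) ` ?W \<inter> covers R (U - {a}) k = {}" using low by blast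
    qed
    have inj: "inj_on (insert a) ?W" by (auto simp: inj_on_def)
    have split: "covers R U k = covers R (U - {a}) k \<union> covers (insert a R) U k \<union>
        (\<lambda>S. {S, insert a S}) ` ?W"
      using covers_split[OF a, of k] by (simp add: image_Collect)
    have finish: ?thesis if "decomposes D (covers R U k)" "size D = size D1 + size D2" for D
      using that D1(2) D2(2) card_levels_split[OF finU a, of k] by auto
    consider "odd (card U + 1 - k)" "odd (k - card R)" | "even (card U + 1 - k)" | "even (k - card R)"
      by blast
    then show ?thesis
    proof cases
      case 1
      then show ?thesis using covers_decomposition_odd[OF finU] by blast
    next
      case 2
      have "odd (degree (covers R (U - {a}) k) S)" if "S \<in> ?W" for S
        using that degree_lower[of "U - {a}" R S k] a finU 2 k by (auto simp: card_Diff_singleton)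
      then have W_ends: "S \<in># ends D1" if "S \<in> ?W" for S
        using that odd_degree_in_ends[OF D1(1)] by blast
      have W_new: "insert a S \<notin> ?W \<union> \<Union>(covers R (U - {a}) k)" for S using low by blast
      have "\<exists>D'. decomposes D' (covers R (U - {a}) k \<union> (\<lambda>S. {S, insert a S}) ` ?W) \<and>
          size D' = size D1 \<and> (\<forall>v. v \<notin> ?W \<longrightarrow> v \<in># ends D1 \<longrightarrow> v \<in># ends D')"
        by (rule attach_pendant_edges[OF D1(1) card_covers finW inj W_ends W_new])
      then obtain D' where D': "size D' = size D1"
        "decomposes D' (covers R (U - {a}) k \<union> (\<lambda>S. {S, insert a S}) ` ?W)"
        by (elim exE conjE)
      have "decomposes (D' + D2) (covers R U k)"
      proof -
        have "(covers R (U - {a}) k \<union> (\<lambda>S. {S, insert a S}) ` ?W) \<inter> covers (insert a R) U k = {}"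
          using disjoint by (simp only: Int_Un_distrib2 Un_empty)
        from decomposes_union[OF D'(2) D2(1) this] show ?thesis by (simp only: split Un_ac)
      qed
      then show ?thesis by (rule finish) (simp add: D'(1))
    next
      case 3
      let ?V = "insert a ` ?W"
      have "odd (degree (covers (insert a R) U k) T)" if T: "T \<in> ?V" for T
      proof -
        have "card (insert a R) = Suc (card R)" using a finR by simp
        moreover have "card T = k" "insert a R \<subseteq> T" "T \<subseteq> U"
        proof -
          obtain S where S: "T = insert a S" "R \<subseteq> S" "S \<subseteq> U - {a}" "Suc (card S) = k"
            using T by blast
          then have "finite S" "a \<notin> S" using finS by blast+
          then show "card T = k" using S by simp
          show "insert a R \<subseteq> T" "T \<subseteq> U" using S a by blast+
        qed
        ultimately show ?thesis using degree_upper[OF finU, of "insert a R" T k] 3 k by auto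
      qed
      then have V_ends: "T \<in># ends D2" if "T \<in> ?V" for T
        using that odd_degree_in_ends[OF D2(1)] by blast
      have V_new: "T - {a} \<notin> ?V \<union> \<Union>(covers (insert a R) U k)" for T using high by blast
      have inj': "inj_on (\<lambda>T. T - {a}) ?V" by (auto simp: inj_on_def)
      have "\<exists>D'. decomposes D' (covers (insert a R) U k \<union> (\<lambda>T. {T, T - {a}}) ` ?V) \<and>
          size D' = size D2 \<and> (\<forall>v. v \<notin> ?V \<longrightarrow> v \<in># ends D2 \<longrightarrow> v \<in># ends D')"
        by (rule attach_pendant_edges[OF D2(1) card_covers finite_imageI[OF finW] inj' V_ends V_new])
      then obtain D' where D': "size D' = size D2"
        "decomposes D' (covers (insert a R) U k \<union> (\<lambda>T. {T, T - {a}}) ` ?V)"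
        by (elim exE conjE)
      have V: "(\<lambda>T. {T, T - {a}}) ` ?V = (\<lambda>S. {S, insert a S}) ` ?W"
        unfolding image_image by (rule image_cong) auto
      have "decomposes (D' + D1) (covers R U k)"
      proof -
        have "(covers (insert a R) U k \<union> (\<lambda>T. {T, T - {a}}) ` ?V) \<inter> covers R (U - {a}) k = {}"
          unfolding V using disjoint by (simp only: Int_commute Int_Un_distrib Un_empty)
        from decomposes_union[OF D'(2) D1(1) this] show ?thesis by (simp only: split V Un_ac)
      qed
      then show ?thesis by (rule finish) (simp add: D'(1))
    qed
  qed
qed

section \<open>The path number of the Levi graph\<close>

text \<open>Discarding the one-vertex paths turns the multiset into a set without changing the edges,
  because paths with a common edge cannot occur twice.\<close>

lemma path_number_le:
  assumes "simple_graph G" "decomposes D (edges G)"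
  shows "path_number G \<le> size D"
proof -
  define P where "P = {p \<in> set_mset D. 2 \<le> length p}"
  have sub: "path_edges p \<subseteq> edges G" if "p \<in># D" for p
    using walk_edges_subset[OF assms(2) that] by (simp add: path_edges_eq_walk_edges)
  have "is_path G p" if "p \<in> P" for p
  proof -
    have p: "p \<in># D" "2 \<le> length p" using that by (auto simp: P_def)
    have edge: "{p ! i, p ! Suc i} \<in> edges G" if "Suc i < length p" for i
      using sub[OF p(1)] that by (auto simp: path_edges_def)
    have "p ! i \<in> verts G" if "i < length p" for i
    proof (cases "Suc i < length p")
      case True
      then show ?thesis using edge[of i] assms(1) by (auto simp: simple_graph_def)
    next
      case False
      then obtain j where "i = Suc j" using p(2) by (cases i) auto
      then show ?thesis using edge[of j] that assms(1) by (auto simp: simple_graph_def)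
    qed
    then show ?thesis
      using p(1) edge assms(2) by (auto simp: is_path_def adjacent_def decomposes_def in_set_conv_nth)
  qed
  moreover have "(\<Union>p\<in>P. path_edges p) = edges G"
  proof -
    have "edges G = set_mset (\<Sum>p\<in>#D. walk_edges p)"
      using assms(2) by (simp add: decomposes_def)
    also have "\<dots> = (\<Union>p\<in>set_mset D. path_edges p)"
      by (simp add: path_edges_eq_walk_edges)
    also have "\<dots> = (\<Union>p\<in>P. path_edges p)"
      by (auto simp: P_def path_edges_def)
    finally show ?thesis ..
  qed
  moreover have "path_edges p \<inter> path_edges q = {}" if pq: "p \<in> P" "q \<in> P" "p \<noteq> q" for p q
  proof -
    obtain D0 where "D = add_mset p D0" using pq(1) by (auto simp: P_def dest: multi_member_split)
    moreover from this obtain D1 where "D0 = add_mset q D1"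
      using pq by (auto simp: P_def dest: multi_member_split)
    ultimately have sum: "mset_set (edges G) =
        walk_edges p + walk_edges q + (\<Sum>r\<in>#D1. walk_edges r)"
      using assms(2) by (simp add: decomposes_def add.assoc)
    have False if "e \<in># walk_edges p" "e \<in># walk_edges q" for e
    proof -
      have "count (mset_set (edges G)) e \<ge> 2"
        using that unfolding sum by (simp add: Suc_le_eq add_mono flip: count_greater_zero_iff)
      then show False by (simp add: count_mset_set' split: if_splits)
    qed
    then show ?thesis by (auto simp: path_edges_eq_walk_edges)
  qed
  ultimately have "path_decomposition G P" by (auto simp: path_decomposition_def P_def)
  then have "path_number G \<le> card P" unfolding path_number_def by (blast intro: Least_le)
  also have "\<dots> \<le> card (set_mset D)" by (rule card_mono) (auto simp: P_def)
  also have "\<dots> \<le> size D" by (induction D) (auto simp: card_insert_if)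
  finally show ?thesis .
qed

lemma levi_graph_eq_covers:
  assumes "1 \<le> k"
  shows "levi_graph m k = (levels {} {1..m} k, covers {} {1..m} k)"
proof -
  have "edges (levi_graph m k) = covers {} {1..m} k"
  proof (intro equalityI subsetI)
    fix e assume "e \<in> edges (levi_graph m k)"
    then obtain S T where ST: "e = {S, T}" "T \<subseteq> {1..m}" "card S = k - 1" "card T = k" "S \<subset> T"
      by (auto simp: levi_graph_def levi_A_def levi_B_def)
    have fin: "finite T" using ST(2) finite_subset by blast
    then have "finite S" using ST(5) by (meson finite_subset psubset_imp_subset)
    then have "card (T - S) = 1" using ST assms by (simp add: card_Diff_subset psubset_imp_subset)
    then obtain x where "T - S = {x}" by (auto simp: card_1_singleton_iff)
    then have "T = insert x S" "x \<in> {1..m}" "x \<notin> S" using ST(2,5) by blast+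
    then show "e \<in> covers {} {1..m} k" unfolding ST(1)
      using ST(2,3,5) assms by (auto intro!: coversI)
  next
    fix e assume "e \<in> covers {} {1..m} k"
    then obtain S x where S: "e = {S, insert x S}" "S \<subseteq> {1..m}" "x \<in> {1..m}" "x \<notin> S" "Suc (card S) = k"
      by (blast elim: coversE)
    have "finite S" using S(2) finite_subset by blast
    then have "S \<in> levi_A m k" "insert x S \<in> levi_B m k" "S \<subset> insert x S"
      using S by (auto simp: levi_A_def levi_B_def)
    then show "e \<in> edges (levi_graph m k)" unfolding S(1) levi_graph_def snd_conv by blast
  qed
  moreover have "verts (levi_graph m k) = levels {} {1..m} k"
    using assms by (auto simp: levi_graph_def levi_A_def levi_B_def levels_def)
  ultimately show ?thesis by (simp add: prod_eq_iff)
qed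

theorem theorem1p1:
  fixes m k n :: nat
  assumes "m \<ge> 2" and "2 \<le> k" and "k \<le> m"
    and "n = (m choose (k - 1)) + (m choose k)"
  shows "path_number (levi_graph m k) \<le> n div 2"
proof -
  have k: "1 \<le> k" using assms(2) by simp
  obtain D where D: "decomposes D (covers {} {1..m} k)" "2 * size D \<le> card (levels {} {1..m} k)"
    using covers_decomposition[of "{1..m}" "{}" k] by auto
  have "2 * size D \<le> n"
    using D(2) card_verts_levi_graph[OF k, of m] assms(4) by (simp add: levi_graph_eq_covers[OF k])
  moreover have "path_number (levi_graph m k) \<le> size D"
    using D(1) by (intro path_number_le simple_graph_levi_graph) (simp add: levi_graph_eq_covers[OF k])
  ultimately show ?thesis by linarith
qed

end
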